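(* Let $f:\mathbb E\to\mathbb R\cup\{+\infty\}$ be a proper extended real function, $\bar x\in\mathrm{dom}\,f$, and let $n\ge2$ be an integer. Then the following three conditions are equivalent: (a) $\bar x$ is an isolated local minimizer of order $n$ of $f$; (b) $0\in\partial^{(1)}_-f(\bar x)$, $0\in\partial^{(i)}_-f(\bar x;\underbrace{0,\dots,0}_{(i-1)\text{ times}})$ for all $i=1,2,\dots,n-1$, and \[ f^{(n)}_-(\bar x;\underbrace{0,0,\dots,0}_{(n-1)\text{ times}};u)>0\quad\text{for all } u\in\mathbb E\setminus\{0\}; \] (c) $\bar x$ is a stationary point of order $n$ of $f$, and $f^{(n)}_-(\bar x;\underbrace{0,0,\dots,0}_{(n-1)\text{ times}};u)>0$ for every direction $u\ne0$ which is critical of order $n$ at $\bar x$.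
   Context: $\mathbb E$ is a real finite-dimensional Euclidean space. $L^1(\mathbb E)=L(\mathbb E,\mathbb R)$ is the space of continuous linear functionals on $\mathbb E$ and, for $n>1$, $L^n(\mathbb E)=L(\mathbb E,L^{n-1}(\mathbb E))$. A proper extended real function is $f:\mathbb E\to\mathbb R\cup\{+\infty\}$ having at least one finite value; $\mathrm{dom}\,f=\{x\mid f(x)<+\infty\}$. For $x\in\mathrm{dom}\,f$ and $u\in\mathbb E$, \[ f^{(1)}_-(x;u)=\liminf_{t\downarrow 0,\,u'\to u}t^{-1}[f(x+tu')-f(x)],\qquad \partial^{(1)}_-f(x)=\{x^*\in L^1(\mathbb E)\mid x^*(u)\le f^{(1)}_-(x;u)\ \forall u\in\mathbb E\}. \] Recursively, for $n>1$: given $x^*_i\in\partial^{(i)}_-f(x;x_1^*,\dots,x_{i-1}^* )$ for $i=1,\dots,n-1$ (for $i=1$ this means $x_1^*\in\partial^{(1)}_-f(x)$), the lower Hadamard derivative of order $n$ is \[ f^{(n)}_-(x;x_1^*,\dots,x_{n-1}^*;u)=\liminf_{t\downarrow0,\,u'\to u} n!\,t^{-n}\Big[f(x+tu')-f(x)-\sum_{i=1}^{n-1}\frac{t^i}{i!}\,x_i^*\underbrace{(u')\cdots(u')}_{i\text{ times}}\Big]\in[-\infty,+\infty], \] and it is defined only for such $x_i^*$. The lower Hadamard subdifferential of order $n$ is \[ \partial^{(n)}_-f(x;x_1^*,\dots,x_{n-1}^* )=\{x^*\in L^n(\mathbb E)\mid x^*\underbrace{(u)\cdots(u)}_{n\text{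 times}}\le f^{(n)}_-(x;x_1^*,\dots,x_{n-1}^*;u)\ \forall u\in\mathbb E\}. \] Below, in $f^{(k)}_-(x;0,\dots,0;u)$ there are $k-1$ zeros. Isolated local minimizer of order $n$: a point $\bar x\in\mathrm{dom}\,f$ for which there exist a neighborhood $N$ of $\bar x$ and a constant $C>0$ with $f(x)\ge f(\bar x)+C\|x-\bar x\|^n$ for all $x\in N$. Stationary point of order $n$: a point $x\in\mathrm{dom}\,f$ such that $f^{(1)}_-(x;u)\ge0$ and $f^{(k)}_-(x;0,\dots,0;u)\ge0$ for $k=2,\dots,n$, for all $u\in\mathbb E$ (each derivative being well defined because the preceding conditions give $0\in\partial^{(i)}_-f(x;0,\dots,0)$ for $i<k$). Critical direction of order $m$: if $x$ is a stationary point of order $n$ and $m\le n$ is a positive integer, a direction $d\in\mathbb E$ is critical of order $m$ at $x$ iff $f^{(1)}_-(x;d)\le0$, $f^{(2)}_-(x;0;d)\le0$, ..., $f^{(m)}_-(x;0,\dots,0;d)\le0$. *)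

theory Defs
  imports "HOL-Analysis.Analysis"
begin

text \<open>
  The type of the space \<open>L\<^sup>n(E) = L(E, L\<^sup>n\<^sup>-\<^sup>1(E))\<close> depends on \<open>n\<close>, so an element \<open>T\<close> of it is
  encoded by the function on argument lists that sends \<open>[u1, ..., un]\<close> to \<open>T(u1)...(un)\<close> and
  every list of a different length to \<open>0\<close>, which makes the encoding unique; \<open>L\<^sup>0(E)\<close> is the
  scalar field. The last conjunct of the recursion says that \<open>u \<mapsto> T(u)\<close> is linear and continuous
  for pointwise convergence in \<open>L\<^sup>n(E)\<close>, which is norm continuity as \<open>E\<close> is finite-dimensional.
  The zero element is \<open>\<lambda>_. 0\<close>.
\<close>

primrec Lspace :: "nat \<Rightarrow> ('a::euclidean_space list \<Rightarrow> real) set" where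
  "Lspace 0 = {T. \<forall>us. us \<noteq> [] \<longrightarrow> T us = 0}"
| "Lspace (Suc n) = {T. T [] = 0 \<and> (\<forall>u. (\<lambda>us. T (u # us)) \<in> Lspace n) \<and>
     (\<forall>us. bounded_linear (\<lambda>u. T (u # us)))}"

definition proper_fun :: "('a \<Rightarrow> ereal) \<Rightarrow> bool" where
  "proper_fun f \<longleftrightarrow> (\<forall>x. f x \<noteq> -\<infinity>) \<and> (\<exists>x. f x \<noteq> \<infinity>)"

definition dom_fun :: "('a \<Rightarrow> ereal) \<Rightarrow> 'a set" where
  "dom_fun f = {x. f x < \<infinity>}"

text \<open>
  The list \<open>xs\<close> holds \<open>x1*, ..., x(n-1)*\<close>, so the order is \<open>n = length xs + 1\<close>, and \<open>xs = []\<close> gives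
  the first-order notions. The definitions are total; they are meaningful only
  for \<open>x \<in> dom_fun f\<close> and \<open>xs ! i \<in> lower_hadamard_subdiff f x (take i xs)\<close> for all
  \<open>i < length xs\<close>. The approach \<open>u' \<rightarrow> u\<close> in the lower limit allows \<open>u' = u\<close>.
\<close>

definition lower_hadamard_deriv ::
  "('a::euclidean_space \<Rightarrow> ereal) \<Rightarrow> 'a \<Rightarrow> ('a list \<Rightarrow> real) list \<Rightarrow> 'a \<Rightarrow> ereal" where
  "lower_hadamard_deriv f x xs u =
     (let n = length xs + 1 in
      Liminf (at_right (0::real) \<times>\<^sub>F nhds u)
        (\<lambda>(t, u'). ereal (fact n / t ^ n) *
           (f (x + t *\<^sub>R u') - f x -
            ereal (\<Sum>i=1..n-1. t ^ i / fact i * (xs ! (i - 1)) (replicate i u')))))"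

definition lower_hadamard_subdiff ::
  "('a::euclidean_space \<Rightarrow> ereal) \<Rightarrow> 'a \<Rightarrow> ('a list \<Rightarrow> real) list \<Rightarrow> ('a list \<Rightarrow> real) set" where
  "lower_hadamard_subdiff f x xs =
     (let n = length xs + 1 in
      {T \<in> Lspace n. \<forall>u. ereal (T (replicate n u)) \<le> lower_hadamard_deriv f x xs u})"

definition isolated_local_minimizer :: "nat \<Rightarrow> ('a::euclidean_space \<Rightarrow> ereal) \<Rightarrow> 'a \<Rightarrow> bool" where
  "isolated_local_minimizer n f x \<longleftrightarrow> x \<in> dom_fun f \<and>
     (\<exists>C>0. \<forall>\<^sub>F y in nhds x. f y \<ge> f x + ereal (C * norm (y - x) ^ n))"

definition stationary_point :: "nat \<Rightarrow> ('a::euclidean_space \<Rightarrow> ereal) \<Rightarrow> 'a \<Rightarrow> bool" where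
  "stationary_point n f x \<longleftrightarrow> x \<in> dom_fun f \<and>
     (\<forall>k\<in>{1..n}. \<forall>u. lower_hadamard_deriv f x (replicate (k - 1) (\<lambda>_. 0)) u \<ge> 0)"

text \<open>Intended for \<open>1 \<le> m\<close> and a point \<open>x\<close> that is stationary of some order \<open>n \<ge> m\<close>.\<close>

definition critical_direction ::
  "nat \<Rightarrow> ('a::euclidean_space \<Rightarrow> ereal) \<Rightarrow> 'a \<Rightarrow> 'a \<Rightarrow> bool" where
  "critical_direction m f x d \<longleftrightarrow>
     (\<forall>k\<in>{1..m}. lower_hadamard_deriv f x (replicate (k - 1) (\<lambda>_. 0)) d \<le> 0)"

end

theory Submission
  imports Defs
begin

text \<open>
  With zero lower-order data the Taylor sum vanishes, so \<open>f\<^sub>-\<^sup>(\<^sup>k\<^sup>)(x;0,...,0;u)\<close> is the lower limit of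
  \<open>k! (f(x + t u') - f x) / t\<^sup>k\<close>. It is positive exactly when \<open>f\<close> grows at least like \<open>c t\<^sup>k\<close> along
  all directions near \<open>u\<close>, with some \<open>c > 0\<close> (\<open>zero_deriv_pos_iff_growth\<close>). Everything rests on
  this reformulation.

  An isolated minimizer of order \<open>n\<close> visibly has growth of order \<open>n\<close> along every nonzero direction,
  and minimality alone makes all the lower derivatives nonnegative. Conversely, growth of order
  \<open>n\<close> along each single nonzero direction comes with a neighbourhood of directions and a constant;
  as the unit sphere is compact, finitely many of them suffice, and the smallest constant works
  uniformly (\<open>isolated_local_minimizer_if_growth\<close>). Finally, since \<open>t\<^sup>n \<le> t\<^sup>k\<close> for
  \<open>k \<le> n\<close> and \<open>t \<le> 1\<close>, a direction with a positive derivative of some order \<open>k \<le> n\<close> also has a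
  positive derivative of order \<open>n\<close> (\<open>directional_growth_mono\<close>); hence positivity
  of the derivative of order \<open>n\<close> need only be required on critical directions.
\<close>

definition directional_growth ::
  "nat \<Rightarrow> ('a::euclidean_space \<Rightarrow> ereal) \<Rightarrow> 'a \<Rightarrow> 'a \<Rightarrow> bool" where
  "directional_growth k f x u \<longleftrightarrow> (\<exists>c>0. \<forall>\<^sub>F (t, u') in at_right (0::real) \<times>\<^sub>F nhds u.
     f x + ereal (c * t ^ k) \<le> f (x + t *\<^sub>R u'))"

lemma zero_in_Lspace: "(\<lambda>_. 0) \<in> Lspace n"
  by (induction n) auto

lemma lower_hadamard_deriv_zeros:
  assumes "k \<ge> 1"
  shows "lower_hadamard_deriv f x (replicate (k - 1) (\<lambda>_. 0)) u =
    Liminf (at_right (0::real) \<times>\<^sub>F nhds u)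
      (\<lambda>(t, u'). ereal (fact k / t ^ k) * (f (x + t *\<^sub>R u') - f x))"
proof -
  have "(\<Sum>i=1..k-1. t ^ i / fact i * ((replicate (k - 1) (\<lambda>_. 0)) ! (i - 1)) (replicate i v)) = (0::real)"
    for t and v :: 'a
    by (intro sum.neutral) auto
  then show ?thesis
    using assms by (simp add: lower_hadamard_deriv_def zero_ereal_def [symmetric])
qed

lemma zero_in_subdiff_iff:
  assumes "k \<ge> 1"
  shows "(\<lambda>_. 0) \<in> lower_hadamard_subdiff f x (replicate (k - 1) (\<lambda>_. 0)) \<longleftrightarrow>
    (\<forall>u. 0 \<le> lower_hadamard_deriv f x (replicate (k - 1) (\<lambda>_. 0)) u)"
  using zero_in_Lspace[of k] assms
  by (auto simp: lower_hadamard_subdiff_def zero_ereal_def[symmetric] simp del: Lspace.simps)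

lemma eventually_positive_step:
  "\<forall>\<^sub>F (t, u') in at_right (0::real) \<times>\<^sub>F F. 0 < t"
  using filterlim_fst[of "at_right (0::real)" F]
  by (simp add: filterlim_iff case_prod_unfold eventually_at_right_less)

lemma eventually_along_direction:
  fixes x u :: "'a::real_normed_vector"
  assumes "\<forall>\<^sub>F y in nhds x. P y"
  shows "\<forall>\<^sub>F (t, u') in at_right (0::real) \<times>\<^sub>F nhds u. P (x + t *\<^sub>R u')"
proof -
  let ?F = "at_right (0::real) \<times>\<^sub>F nhds u"
  have "((\<lambda>p. fst p) \<longlongrightarrow> 0) ?F"
    using filterlim_fst[of "at_right (0::real)" "nhds u"]
    by (rule filterlim_mono) (auto simp: at_within_le_nhds)
  moreover have "((\<lambda>p. snd p) \<longlongrightarrow> u) ?F"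
    by (rule filterlim_snd)
  ultimately have "((\<lambda>p. x + fst p *\<^sub>R snd p) \<longlongrightarrow> x + 0 *\<^sub>R u) ?F"
    by (intro tendsto_intros)
  then show ?thesis
    using assms by (simp add: filterlim_iff case_prod_unfold)
qed

lemma scaled_increment_ge_iff:
  fixes a b :: ereal
  assumes "\<bar>a\<bar> \<noteq> \<infinity>" "0 < s"
  shows "ereal c \<le> ereal s * (b - a) \<longleftrightarrow> a + ereal (c / s) \<le> b"
  using assms by (cases a; cases b) (auto simp: field_simps)

lemma zero_deriv_pos_iff_growth:
  assumes "\<bar>f x\<bar> \<noteq> \<infinity>" "k \<ge> 1"
  shows "0 < lower_hadamard_deriv f x (replicate (k - 1) (\<lambda>_. 0)) u \<longleftrightarrow> directional_growth k f x u"
    (is "0 < ?D \<longleftrightarrow> _")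
proof
  let ?F = "at_right (0::real) \<times>\<^sub>F nhds u"
  let ?q = "\<lambda>(t, u'). ereal (fact k / t ^ k) * (f (x + t *\<^sub>R u') - f x)"
  note D = lower_hadamard_deriv_zeros[OF assms(2), of f x u]
  {
    assume "0 < ?D"
    then obtain c where c: "0 < ereal c" "ereal c < ?D"
      using ereal_dense2 by blast
    have "\<forall>\<^sub>F p in ?F. ereal c < ?q p"
      using less_LiminfD[of "ereal c" ?F ?q] c(2) D by simp
    then have "\<forall>\<^sub>F (t, u') in ?F. f x + ereal (c / fact k * t ^ k) \<le> f (x + t *\<^sub>R u')"
      using eventually_positive_step
    proof eventually_elim
      case (elim p)
      then show ?case
        using scaled_increment_ge_iff[OF assms(1), of "fact k / fst p ^ k" c "f (x + fst p *\<^sub>R snd p)"]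
        by (auto simp: case_prod_beta)
    qed
    moreover have "0 < c / fact k"
      using c by simp
    ultimately show "directional_growth k f x u"
      unfolding directional_growth_def by blast
  next
    assume "directional_growth k f x u"
    then obtain c where c: "c > 0"
      "\<forall>\<^sub>F (t, u') in ?F. f x + ereal (c * t ^ k) \<le> f (x + t *\<^sub>R u')"
      unfolding directional_growth_def by blast
    from c(2) eventually_positive_step have "\<forall>\<^sub>F p in ?F. ereal (c * fact k) \<le> ?q p"
    proof eventually_elim
      case (elim p)
      then show ?case
        using scaled_increment_ge_iff[OF assms(1), of "fact k / fst p ^ k" "c * fact k"
            "f (x + fst p *\<^sub>R snd p)"]
        by (auto simp: case_prod_beta)
    qed
    then have "ereal (c * fact k) \<le> ?D"
      unfolding D by (rule Liminf_bounded)
    moreover have "0 < ereal (c * fact k)"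
      using c(1) by simp
    ultimately show "0 < ?D"
      by order
  }
qed

lemma zero_deriv_nonneg_at_local_min:
  assumes "\<bar>f x\<bar> \<noteq> \<infinity>" "k \<ge> 1" "\<forall>\<^sub>F y in nhds x. f x \<le> f y"
  shows "0 \<le> lower_hadamard_deriv f x (replicate (k - 1) (\<lambda>_. 0)) u"
proof -
  have "\<forall>\<^sub>F (t, u') in at_right (0::real) \<times>\<^sub>F nhds u.
      0 \<le> ereal (fact k / t ^ k) * (f (x + t *\<^sub>R u') - f x)"
    using eventually_along_direction[OF assms(3)] eventually_positive_step
  proof eventually_elim
    case (elim p)
    then show ?case
      using scaled_increment_ge_iff[OF assms(1), of "fact k / fst p ^ k" 0 "f (x + fst p *\<^sub>R snd p)"]
      by (auto simp: case_prod_beta zero_ereal_def[symmetric])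
  qed
  then show ?thesis
    unfolding lower_hadamard_deriv_zeros[OF assms(2)]
    by (intro Liminf_bounded) (simp add: case_prod_unfold)
qed

text \<open>
  A positive derivative of low order forces one of higher order, because near
  \<open>t = 0\<close> the higher power is the smaller one.
\<close>

lemma directional_growth_mono:
  assumes "directional_growth k f x u" "k \<le> n"
  shows "directional_growth n f x u"
proof -
  let ?F = "at_right (0::real) \<times>\<^sub>F nhds u"
  obtain c where c: "c > 0" "\<forall>\<^sub>F (t, u') in ?F. f x + ereal (c * t ^ k) \<le> f (x + t *\<^sub>R u')"
    using assms(1) unfolding directional_growth_def by blast
  have "\<forall>\<^sub>F p in ?F. fst p < 1"
    using filterlim_fst[of "at_right (0::real)" "nhds u"] eventually_at_right_real[of 0 "1::real"]
    by (auto simp: filterlim_iff elim: eventually_mono)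
  with c(2) eventually_positive_step
  have "\<forall>\<^sub>F (t, u') in ?F. f x + ereal (c * t ^ n) \<le> f (x + t *\<^sub>R u')"
  proof eventually_elim
    case (elim p)
    then have "c * fst p ^ n \<le> c * fst p ^ k"
      using c(1) assms(2) by (auto intro!: mult_left_mono power_decreasing)
    then have "f x + ereal (c * fst p ^ n) \<le> f x + ereal (c * fst p ^ k)"
      by (intro add_left_mono) simp
    with elim show ?case
      by (auto simp: case_prod_beta)
  qed
  with c(1) show ?thesis
    unfolding directional_growth_def by blast
qed

lemma growth_if_isolated_local_minimizer:
  assumes "isolated_local_minimizer n f x" "u \<noteq> 0"
  shows "directional_growth n f x u"
proof -
  let ?F = "at_right (0::real) \<times>\<^sub>F nhds u"
  obtain C where C: "C > 0" "\<forall>\<^sub>F y in nhds x. f x + ereal (C * norm (y - x) ^ n) \<le> f y"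
    using assms(1) unfolding isolated_local_minimizer_def by blast
  have "\<forall>\<^sub>F v in nhds u. norm u / 2 < norm v"
    using order_tendstoD(1)[OF tendsto_norm[OF filterlim_ident[of "nhds u"]], of "norm u / 2"]
      assms(2) by simp
  then have "\<forall>\<^sub>F p in ?F. norm u / 2 < norm (snd p)"
    using filterlim_snd[of "nhds u" "at_right (0::real)"] by (auto simp: filterlim_iff)
  with eventually_along_direction[OF C(2)] eventually_positive_step
  have "\<forall>\<^sub>F (t, u') in ?F. f x + ereal (C * (norm u / 2) ^ n * t ^ n) \<le> f (x + t *\<^sub>R u')"
  proof eventually_elim
    case (elim p)
    then have "(norm u / 2 * fst p) ^ n \<le> norm (fst p *\<^sub>R snd p) ^ n"
      by (intro power_mono) (auto simp: case_prod_beta mult.commute)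
    then have "C * (norm u / 2) ^ n * fst p ^ n \<le> C * norm (fst p *\<^sub>R snd p) ^ n"
      using C(1) by (simp only: power_mult_distrib[symmetric] mult.assoc mult_le_cancel_left_pos)
    then have "f x + ereal (C * (norm u / 2) ^ n * fst p ^ n)
        \<le> f x + ereal (C * norm (fst p *\<^sub>R snd p) ^ n)"
      by (intro add_left_mono) simp
    with elim show ?case
      by (auto simp: case_prod_beta)
  qed
  moreover have "0 < C * (norm u / 2) ^ n"
    using C(1) assms(2) by simp
  ultimately show ?thesis
    unfolding directional_growth_def by blast
qed

text \<open>
  The step that needs finite dimension. A point \<open>y \<noteq> x\<close> is reached from \<open>x\<close> by the step
  \<open>t = norm (y - x)\<close> along a unit vector, so uniform growth over the compact unit
  sphere is growth in \<open>norm (y - x)\<close>.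
\<close>

lemma isolated_local_minimizer_if_growth:
  fixes f :: "'a::euclidean_space \<Rightarrow> ereal"
  assumes "x \<in> dom_fun f" "n \<ge> 1" "\<And>u. u \<noteq> 0 \<Longrightarrow> directional_growth n f x u"
  shows "isolated_local_minimizer n f x"
proof -
  let ?S = "sphere (0::'a) 1"
  have "\<exists>c d V. c > 0 \<and> d > 0 \<and> open V \<and> u \<in> V \<and>
      (\<forall>t v. 0 < t \<and> t < d \<and> v \<in> V \<longrightarrow> f x + ereal (c * t ^ n) \<le> f (x + t *\<^sub>R v))"
    if "u \<in> ?S" for u
  proof -
    have "u \<noteq> 0"
      using that by auto
    from assms(3)[OF this] obtain c where c: "c > 0"
      "\<forall>\<^sub>F (t, u') in at_right (0::real) \<times>\<^sub>F nhds u. f x + ereal (c * t ^ n) \<le> f (x + t *\<^sub>R u')"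
      unfolding directional_growth_def by blast
    obtain P Q where PQ: "eventually P (at_right (0::real))" "eventually Q (nhds u)"
      "\<And>t v. P t \<Longrightarrow> Q v \<Longrightarrow> f x + ereal (c * t ^ n) \<le> f (x + t *\<^sub>R v)"
      using c(2) unfolding eventually_prod_filter by auto
    obtain d where "d > 0" "\<And>t. 0 < t \<Longrightarrow> t < d \<Longrightarrow> P t"
      using PQ(1) unfolding eventually_at_right_field by blast
    moreover obtain V where "open V" "u \<in> V" "\<And>v. v \<in> V \<Longrightarrow> Q v"
      using PQ(2) unfolding eventually_nhds by blast
    ultimately show ?thesis
      using c(1) PQ(3) by blast
  qed
  then obtain c d V where cdV:
    "\<And>u. u \<in> ?S \<Longrightarrow> c u > 0 \<and> d u > 0 \<and> open (V u) \<and> u \<in> V u"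
    "\<And>u t v. u \<in> ?S \<Longrightarrow> 0 < t \<Longrightarrow> t < d u \<Longrightarrow> v \<in> V u \<Longrightarrow>
       f x + ereal (c u * t ^ n) \<le> f (x + t *\<^sub>R v)"
    by metis
  obtain U where U: "U \<subseteq> ?S" "finite U" "?S \<subseteq> (\<Union>u\<in>U. V u)"
    using compactE_image[OF compact_sphere, of ?S V] cdV(1) by (metis UN_I subsetI)
  \<comment> \<open>Inserting 1 keeps the minima meaningful without arguing that the subcover is nonempty.\<close>
  define C where "C = Min (insert 1 (c ` U))"
  define r where "r = Min (insert 1 (d ` U))"
  have pos: "C > 0" "r > 0"
    using U cdV(1) unfolding C_def r_def by (auto simp: subset_iff)
  have bounds: "C \<le> c u" "r \<le> d u" if "u \<in> U" for u
    using U(2) that unfolding C_def r_def by auto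
  have "f x + ereal (C * norm (y - x) ^ n) \<le> f y" if "dist y x < r" for y
  proof (cases "y = x")
    case True
    then show ?thesis
      using assms(2) by (simp add: power_0_left zero_ereal_def[symmetric])
  next
    case False
    define t v where "t = norm (y - x)" and "v = (y - x) /\<^sub>R t"
    have t: "0 < t" "t < r" and y: "x + t *\<^sub>R v = y" and "v \<in> ?S"
      using False that by (auto simp: t_def v_def dist_norm)
    then obtain u where u: "u \<in> U" "v \<in> V u"
      using U(3) by blast
    have "C * t ^ n \<le> c u * t ^ n"
      using bounds(1)[OF u(1)] t(1) by (intro mult_right_mono) auto
    then have "f x + ereal (C * t ^ n) \<le> f x + ereal (c u * t ^ n)"
      by (intro add_left_mono) simp
    also have "\<dots> \<le> f (x + t *\<^sub>R v)"
      using u t U(1) bounds(2)[OF u(1)] by (intro cdV(2)) auto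
    finally show ?thesis
      using y t_def by simp
  qed
  then have "\<forall>\<^sub>F y in nhds x. f x + ereal (C * norm (y - x) ^ n) \<le> f y"
    unfolding eventually_nhds_metric using pos(2) by blast
  then show ?thesis
    unfolding isolated_local_minimizer_def using assms(1) pos(1) by blast
qed

theorem theorem5p1:
  fixes f :: "'a::euclidean_space \<Rightarrow> ereal" and x :: 'a and n :: nat
  assumes "proper_fun f" and "x \<in> dom_fun f" and "n \<ge> 2"
  shows
    "(isolated_local_minimizer n f x \<longleftrightarrow>
        (\<forall>i\<in>{1..n-1}. (\<lambda>_. 0) \<in> lower_hadamard_subdiff f x (replicate (i - 1) (\<lambda>_. 0))) \<and>
        (\<forall>u. u \<noteq> 0 \<longrightarrow> lower_hadamard_deriv f x (replicate (n - 1) (\<lambda>_. 0)) u > 0))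
   \<and> (isolated_local_minimizer n f x \<longleftrightarrow>
        stationary_point n f x \<and>
        (\<forall>u. u \<noteq> 0 \<and> critical_direction n f x u \<longrightarrow>
           lower_hadamard_deriv f x (replicate (n - 1) (\<lambda>_. 0)) u > 0))"
proof -
  let ?D = "\<lambda>k u. lower_hadamard_deriv f x (replicate (k - 1) (\<lambda>_. 0)) u"
  have fin: "\<bar>f x\<bar> \<noteq> \<infinity>"
    using assms(1,2) by (auto simp: proper_fun_def dom_fun_def)
  have n: "n \<ge> 1"
    using assms(3) by simp
  have iso: "isolated_local_minimizer n f x \<longleftrightarrow> (\<forall>u. u \<noteq> 0 \<longrightarrow> ?D n u > 0)"
    using isolated_local_minimizer_if_growth[OF assms(2) n] growth_if_isolated_local_minimizer[of n f x]
      zero_deriv_pos_iff_growth[of f x n, OF fin n] by blast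
  have nonneg: "0 \<le> ?D k u" if min: "isolated_local_minimizer n f x" and k: "k \<ge> 1" for k u
  proof (rule zero_deriv_nonneg_at_local_min[of f x, OF fin k])
    obtain C where C: "C > 0" "\<forall>\<^sub>F y in nhds x. f x + ereal (C * norm (y - x) ^ n) \<le> f y"
      using min unfolding isolated_local_minimizer_def by blast
    from C(2) show "\<forall>\<^sub>F y in nhds x. f x \<le> f y"
    proof eventually_elim
      case (elim y)
      have "f x + 0 \<le> f x + ereal (C * norm (y - x) ^ n)"
        using C(1) by (intro add_left_mono) simp
      with elim show ?case
        by simp
    qed
  qed
  \<comment> \<open>A noncritical direction has a positive derivative of some order \<open>k \<le> n\<close>, hence of order \<open>n\<close>.\<close>
  have noncritical: "?D n u > 0" if "\<not> critical_direction n f x u" for u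
  proof -
    from that obtain k where k: "k \<ge> 1" "k \<le> n" "?D k u > 0"
      unfolding critical_direction_def by (auto simp: not_le)
    then show ?thesis
      using zero_deriv_pos_iff_growth[of f x, OF fin] directional_growth_mono n by blast
  qed
  show ?thesis
  proof (intro conjI)
    show "isolated_local_minimizer n f x \<longleftrightarrow>
        (\<forall>i\<in>{1..n-1}. (\<lambda>_. 0) \<in> lower_hadamard_subdiff f x (replicate (i - 1) (\<lambda>_. 0))) \<and>
        (\<forall>u. u \<noteq> 0 \<longrightarrow> ?D n u > 0)"
      using iso nonneg zero_in_subdiff_iff[of _ f x] by (meson atLeastAtMost_iff)
    show "isolated_local_minimizer n f x \<longleftrightarrow>
        stationary_point n f x \<and> (\<forall>u. u \<noteq> 0 \<and> critical_direction n f x u \<longrightarrow> ?D n u > 0)"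
      unfolding stationary_point_def using iso nonneg noncritical assms(2)
      by (meson atLeastAtMost_iff)
  qed
qed

end
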